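(* Let $X$ be an inner product space with induced norm $\|\cdot\|$, let $\varepsilon\in[0,1)$ and let $x,y\in X$. Then the relations $\perp_{HH-I}^{\varepsilon}$ and ${}^{\varepsilon}\perp_{HH-I}$ are symmetric, that is: (i) if $x\perp_{HH-I}^{\varepsilon}y$, then $y\perp_{HH-I}^{\varepsilon}x$; (ii) if $x\,{}^{\varepsilon}\!\perp_{HH-I}y$, then $y\,{}^{\varepsilon}\!\perp_{HH-I}x$.
   Context: Inner product spaces are over $\mathbb{R}$ or $\mathbb{C}$. For $\varepsilon\in[0,1)$ and $x,y\in X$ two relations of approximate $HH-I$ orthogonality are defined. $x\,{}^{\varepsilon}\!\perp_{HH-I}y$ means $$\left|\int_0^1\|(1-t)x+ty\|^2dt-\int_0^1\|(1-t)x-ty\|^2dt\right|\le\varepsilon\left(\int_0^1\|(1-t)x+ty\|^2dt+\int_0^1\|(1-t)x-ty\|^2dt\right).$$ $x\perp_{HH-I}^{\varepsilon}y$ means $$\left|\int_0^1\|(1-t)x+ty\|^2dt-\int_0^1\|(1-t)x-ty\|^2dt\right|\le\frac23\,\varepsilon\,\|x\|\,\|y\|.$$ *)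

theory Defs
  imports "HOL-Analysis.Analysis"
begin

text \<open>
  Real inner product spaces are the library class \<open>real_inner\<close>. The library has no complex
  counterpart, so it is set up here in the same style. The inner product is linear in its
  first argument, and the real scaling that every normed space carries is the restriction of
  the complex one. Extending \<open>real_normed_vector\<close> loses no generality: the norm is fixed by
  \<open>norm_eq_sqrt_cinner\<close>, the remaining axioms make it a norm (Cauchy-Schwarz), and the metric
  and topology are the ones it induces.
\<close>

class complex_inner = real_normed_vector +
  fixes scaleC :: "complex \<Rightarrow> 'a \<Rightarrow> 'a" (infixr \<open>*\<^sub>C\<close> 75)
    and cinner :: "'a \<Rightarrow> 'a \<Rightarrow> complex"
  assumes scaleC_add_right: "a *\<^sub>C (x + y) = a *\<^sub>C x + a *\<^sub>C y"
    and scaleC_add_left: "(a + b) *\<^sub>C x = a *\<^sub>C x + b *\<^sub>C x"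
    and scaleC_scaleC: "a *\<^sub>C b *\<^sub>C x = (a * b) *\<^sub>C x"
    and scaleC_one: "1 *\<^sub>C x = x"
    and scaleR_scaleC: "r *\<^sub>R x = complex_of_real r *\<^sub>C x"
    and cinner_commute: "cinner x y = cnj (cinner y x)"
    and cinner_add_left: "cinner (x + y) z = cinner x z + cinner y z"
    and cinner_scaleC_left: "cinner (a *\<^sub>C x) y = a * cinner x y"
    \<comment> \<open>\<open>cinner x x\<close> is real by \<open>cinner_commute\<close>\<close>
    and cinner_ge_zero: "0 \<le> Re (cinner x x)"
    and cinner_eq_zero_iff: "cinner x x = 0 \<longleftrightarrow> x = 0"
    and norm_eq_sqrt_cinner: "norm x = sqrt (Re (cinner x x))"

instantiation complex :: complex_inner
begin

definition scaleC_complex :: "complex \<Rightarrow> complex \<Rightarrow> complex"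
  where "scaleC_complex a x = a * x"

definition cinner_complex :: "complex \<Rightarrow> complex \<Rightarrow> complex"
  where "cinner_complex x y = x * cnj y"

instance
proof
  fix a b x y z :: complex and r :: real
  show "a *\<^sub>C (x + y) = a *\<^sub>C x + a *\<^sub>C y" "(a + b) *\<^sub>C x = a *\<^sub>C x + b *\<^sub>C x"
    "a *\<^sub>C b *\<^sub>C x = (a * b) *\<^sub>C x" "1 *\<^sub>C x = x"
    "r *\<^sub>R x = complex_of_real r *\<^sub>C x"
    by (simp_all add: scaleC_complex_def algebra_simps scaleR_conv_of_real)
  show "cinner x y = cnj (cinner y x)" "cinner (x + y) z = cinner x z + cinner y z"
    "cinner (a *\<^sub>C x) y = a * cinner x y" "0 \<le> Re (cinner x x)"
    "cinner x x = 0 \<longleftrightarrow> x = 0"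
    by (simp_all add: cinner_complex_def scaleC_complex_def algebra_simps)
  show "norm x = sqrt (Re (cinner x x))"
    by (simp add: cinner_complex_def norm_complex_def power2_eq_square)
qed

end

text \<open>
  The mean squared norm along the segment from \<open>x\<close> to \<open>y\<close>. It involves only the norm and real
  scalars, so one definition covers both kinds of inner product space.
\<close>

definition HH_mean :: "'a::real_normed_vector \<Rightarrow> 'a \<Rightarrow> real"
  where "HH_mean x y = integral {0..1} (\<lambda>t. (norm ((1 - t) *\<^sub>R x + t *\<^sub>R y))\<^sup>2)"

definition HH_mean_diff :: "'a::real_normed_vector \<Rightarrow> 'a \<Rightarrow> real"
  where "HH_mean_diff x y = integral {0..1} (\<lambda>t. (norm ((1 - t) *\<^sub>R x - t *\<^sub>R y))\<^sup>2)"

text \<open>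
  \<open>HH_I_perp_left\<close> has \<open>\<epsilon>\<close> to the left of the orthogonality sign and \<open>HH_I_perp_right\<close> has it
  to the right.
\<close>

definition HH_I_perp_left :: "real \<Rightarrow> 'a::real_normed_vector \<Rightarrow> 'a \<Rightarrow> bool"
  where "HH_I_perp_left \<epsilon> x y \<longleftrightarrow>
    \<bar>HH_mean x y - HH_mean_diff x y\<bar> \<le> \<epsilon> * (HH_mean x y + HH_mean_diff x y)"

definition HH_I_perp_right :: "real \<Rightarrow> 'a::real_normed_vector \<Rightarrow> 'a \<Rightarrow> bool"
  where "HH_I_perp_right \<epsilon> x y \<longleftrightarrow>
    \<bar>HH_mean x y - HH_mean_diff x y\<bar> \<le> 2 / 3 * \<epsilon> * norm x * norm y"

end

theory Submission
  imports Defs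
begin

text \<open>Both relations see \<open>x\<close> and \<open>y\<close> only through the two mean
  values and, for \<open>HH_I_perp_right\<close>, through \<open>norm x * norm y\<close>. Each of
  these is invariant under swapping \<open>x\<close> and \<open>y\<close>, the means by
  \<open>HH_mean_commute\<close> and \<open>HH_mean_diff_commute\<close>.\<close>

text \<open>
  The substitution \<open>t \<mapsto> 1 - t\<close> exchanges the two end points, so both mean values are symmetric
  in any real normed space.
\<close>

lemma integral_reflect_unit_interval:
  fixes f :: "real \<Rightarrow> 'a::real_normed_vector"
  shows "integral {0..1} (\<lambda>t. f (1 - t)) = integral {0..1} f"
proof -
  \<comment> \<open>The map t -> 1 - t is a reflection at 0 followed by a shift by 1. Both preserve
    integrability, and a non-integrable \<open>f\<close> has the default integral 0, so
    \<open>f\<close> is arbitrary.\<close>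
  have "integral {0..1} (\<lambda>t. f (1 - t)) = integral {-1..-0} (\<lambda>t. f (1 + t))"
    using Henstock_Kurzweil_Integration.integral_reflect_real[of 1 0 "\<lambda>t. f (1 - t)"]
    by (simp only: diff_minus_eq_add)
  also have "\<dots> = integral {0..1} f"
    using integral_shift_Icc_real[of "-1" 0 f 1] by (simp add: o_def)
  finally show ?thesis .
qed

lemma HH_mean_commute: "HH_mean x y = HH_mean y x"
  using integral_reflect_unit_interval[of "\<lambda>t. (norm ((1 - t) *\<^sub>R x + t *\<^sub>R y))\<^sup>2"]
  by (simp add: HH_mean_def add.commute)

text \<open>Here the reflection alone yields the negative of the swapped vector; the norm absorbs
  the sign.\<close>

lemma HH_mean_diff_commute: "HH_mean_diff x y = HH_mean_diff y x"
  using integral_reflect_unit_interval[of "\<lambda>t. (norm ((1 - t) *\<^sub>R x - t *\<^sub>R y))\<^sup>2"]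
  by (simp add: HH_mean_diff_def norm_minus_commute)

lemma HH_I_perp_left_commute: "HH_I_perp_left \<epsilon> x y \<longleftrightarrow> HH_I_perp_left \<epsilon> y x"
  unfolding HH_I_perp_left_def
  by (simp only: HH_mean_commute[of x y] HH_mean_diff_commute[of x y])

lemma HH_I_perp_right_commute: "HH_I_perp_right \<epsilon> x y \<longleftrightarrow> HH_I_perp_right \<epsilon> y x"
  unfolding HH_I_perp_right_def
  by (simp add: HH_mean_commute[of x y] HH_mean_diff_commute[of x y] mult_ac)

theorem proposition2p1:
  fixes \<epsilon> :: real
    and x y :: "'a::real_inner"
    and u v :: "'b::complex_inner"
  assumes "0 \<le> \<epsilon>" and "\<epsilon> < 1"
  shows "(HH_I_perp_right \<epsilon> x y \<longrightarrow> HH_I_perp_right \<epsilon> y x) \<and>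
         (HH_I_perp_left \<epsilon> x y \<longrightarrow> HH_I_perp_left \<epsilon> y x) \<and>
         (HH_I_perp_right \<epsilon> u v \<longrightarrow> HH_I_perp_right \<epsilon> v u) \<and>
         (HH_I_perp_left \<epsilon> u v \<longrightarrow> HH_I_perp_left \<epsilon> v u)"
  \<comment> \<open>The real and the complex case are instances of the same symmetry, valid in every
    real normed space.\<close>
  by (simp add: HH_I_perp_left_commute[of _ x] HH_I_perp_left_commute[of _ u]
      HH_I_perp_right_commute[of _ x] HH_I_perp_right_commute[of _ u])

end
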